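(* Let $\mathbf{G}$ be a finite set of generalized path conditions and let $\sigma$ be a sequent. If $\mathrm{NCL}_{\mathbf{G}}\vdash\sigma$ (i.e. $\sigma$ has a proof in the labelled sequent calculus $\mathrm{NCL}_{\mathbf{G}}$), then $\sigma$ is valid over the class of $\mathbf{G}$-frames.
   Context: **Formulae and semantics.** Formulae are generated by $\varphi ::= \bot \mid p \mid (\varphi\to\varphi)\mid \triangle\varphi$, with $p$ in a countably infinite set $\mathsf{Prop}$ ($\triangle$ is the non-contingency operator). A frame is a pair $(W,R)$ with $W\neq\emptyset$ and $R\subseteq W\times W$. A model is $\mathcal{M}=(W,R,V)$ with $(W,R)$ a frame and $V:W\to 2^{\mathsf{Prop}}$. Truth $\mathcal{M},w\models\varphi$ is standard for $\bot$, atoms ($\mathcal{M},w\models p$ iff $p\in V(w)$) and $\to$; and $\mathcal{M},w\models\triangle\varphi$ iff either $\mathcal{M},v\models\varphi$ for all $v$ with $wRv$, or $\mathcal{M},v\not\models\varphi$ for all $v$ with $wRv$. **Words and generalized path conditions (GPCs).** Let $\Sigma=\{x,\overline{x}\}$ and let $\Sigma^*$ be the set of finite words over $\Sigma$, with empty word $\epsilon$. Converse: $\epsilon^{-1}=\epsilon$, $x^{-1}=\overline{x}$, $\overline{x}^{-1}=x$, $(z_1\cdots z_n)^{-1}=z_n^{-1}\cdots z_1^{-1}$. For a set $X$ (possibly empty) and $Q\subseteq X\times X$: $Q_\epsilon=\{(a,a)\mid a\in X\}$, $Q_x=Q$, $Q_{\overline{x}}=Q^{-1}$, and $(a,b)\in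 Q_{z_1\cdots z_n}$ iff there are $a=a_0,\dots,a_n=b$ in $X$ with $(a_{i-1},a_i)\in Q_{z_i}$ for all $1\le i\le n$. A $\Sigma$-system $\mathcal{S}$ is a set of productions $z\mapsto\beta$ with $z\in\Sigma$, $\beta\in\Sigma^*$; $\rho z\tau\mapsto_{\mathcal{S}}\rho\eta\tau$ whenever $z\mapsto\eta\in\mathcal{S}$ and $\rho,\tau\in\Sigma^*$; $\mapsto_{\mathcal{S}}^*$ is the reflexive transitive closure; $\mathcal{L}_{\mathcal{S}}(\beta)=\{\gamma\mid\beta\mapsto^*_{\mathcal{S}}\gamma\}$. For $\alpha\in\Sigma^*$, $\mathcal{S}_\alpha=\{x\mapsto\alpha,\ \overline{x}\mapsto\alpha^{-1}\}$. A frame $(W,R)$ satisfies the GPC $\mathbf{G}(\alpha)$ if $R_\beta\subseteq R$ for every $\beta\in\mathcal{L}_{\mathcal{S}_\alpha}(x)$. For a finite set $\mathbf{G}$ of GPCs, a $\mathbf{G}$-frame is a frame satisfying every member of $\mathbf{G}$, and $\mathcal{S}(\mathbf{G})=\bigcup_{\mathbf{G}(\alpha)\in\mathbf{G}}\mathcal{S}_\alpha$. **Sequents.** Let $\mathsf{Var}$ be a countably infinite set of variables (labels). A relational atom is an expression $\mathsf{x}\,\mathsf{R}\,\mathsf{y}$ and a labelled formula is an expression $\mathsf{x}:\varphi$, with $\mathsf{x},\mathsf{y}\in\mathsf{Var}$ and $\varphi$ a formula. A sequent $\sigma=\Omega\dashv\Gamma\Rightarrow\Delta$ consists of a finite set $\Omega$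 of relational atoms (the control) and finite sets $\Gamma,\Delta$ of labelled formulae. $\mathsf{Var}(\sigma)$ is the set of variables occurring in $\sigma$. For a model $\mathcal{M}=(W,R,V)$ and an assignment $\lambda:\mathsf{Var}\to W$: $\mathcal{M},\lambda\Vdash\mathsf{x}\,\mathsf{R}\,\mathsf{y}$ iff $\lambda(\mathsf{x})R\lambda(\mathsf{y})$; $\mathcal{M},\lambda\Vdash\mathsf{x}:\varphi$ iff $\mathcal{M},\lambda(\mathsf{x})\models\varphi$; and $\mathcal{M},\lambda\Vdash\sigma$ iff, whenever all members of $\Omega$ and all members of $\Gamma$ hold under $\mathcal{M},\lambda$, some member of $\Delta$ holds under $\mathcal{M},\lambda$. $\sigma$ is valid over a class of frames if $\mathcal{M},\lambda\Vdash\sigma$ for every model $\mathcal{M}$ based on a frame in the class and every assignment $\lambda$. **Closure of controls.** For $\sigma=\Omega\dashv\Gamma\Rightarrow\Delta$ put $X=\mathsf{Var}(\sigma)$ and $Q=\{(\mathsf{x},\mathsf{y})\mid \mathsf{x}\,\mathsf{R}\,\mathsf{y}\in\Omega\}\subseteq X\times X$. Then $\mathcal{S}(\mathbf{G})(\Omega)$ is the set of relational atoms $\mathsf{x}\,\mathsf{R}\,\mathsf{y}$ with $(\mathsf{x},\mathsf{y})\in\bigcup_{\beta\in\mathcal{L}_{\mathcal{S}(\mathbf{G})}(x)}Q_\beta$ (computed over the domain $X$). **The calculus $\mathrm{NCL}_{\mathbf{G}}$.** Commas denote set union. Initial sequents: $\Omega\dashv\Gamma,\mathsf{x}:\bot\Rightarrow\Delta$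 and $\Omega\dashv\Gamma,\mathsf{x}:\varphi\Rightarrow\mathsf{x}:\varphi,\Delta$. Rules (premises / conclusion): - ${\to}\mathsf{L}$: from $\Omega\dashv\Gamma\Rightarrow\mathsf{x}:\varphi,\Delta$ and $\Omega\dashv\Gamma,\mathsf{x}:\psi\Rightarrow\Delta$ infer $\Omega\dashv\Gamma,\mathsf{x}:\varphi\to\psi\Rightarrow\Delta$. - ${\to}\mathsf{R}$: from $\Omega\dashv\Gamma,\mathsf{x}:\varphi\Rightarrow\mathsf{x}:\psi,\Delta$ infer $\Omega\dashv\Gamma\Rightarrow\mathsf{x}:\varphi\to\psi,\Delta$. - $\triangle\mathsf{L}$: from $\Omega\dashv\Gamma,\mathsf{x}:\triangle\varphi,\{\mathsf{y}:\varphi\mid\mathsf{x}\,\mathsf{R}\,\mathsf{y}\in\Omega\}\Rightarrow\Delta$ and $\Omega\dashv\Gamma,\mathsf{x}:\triangle\varphi\Rightarrow\{\mathsf{y}:\varphi\mid\mathsf{x}\,\mathsf{R}\,\mathsf{y}\in\Omega\},\Delta$ infer $\Omega\dashv\Gamma,\mathsf{x}:\triangle\varphi\Rightarrow\Delta$. - $\triangle\mathsf{R}$: from $\Omega,\mathsf{x}\,\mathsf{R}\,\mathsf{y},\mathsf{x}\,\mathsf{R}\,\mathsf{z}\dashv\Gamma,\mathsf{y}:\varphi\Rightarrow\mathsf{z}:\varphi,\mathsf{x}:\triangle\varphi,\Delta$ infer $\Omega\dashv\Gamma\Rightarrow\mathsf{x}:\triangle\varphi,\Delta$, provided $\mathsf{y}\neq\mathsf{z}$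 and neither $\mathsf{y}$ nor $\mathsf{z}$ occurs in the conclusion. - $\mathsf{r}_{\mathbf{G}}$: from $\mathcal{S}(\mathbf{G})(\Omega)\dashv\Gamma\Rightarrow\Delta$ infer $\Omega\dashv\Gamma\Rightarrow\Delta$ (closure computed over the variables of the conclusion). A proof of $\sigma$ in $\mathrm{NCL}_{\mathbf{G}}$ is a finite tree labelled by sequents according to the rules, with root labelled $\sigma$ and every leaf labelled by an initial sequent. *)

theory Defs
  imports Main
begin

section \<open>Formulae and semantics\<close>

type_synonym atm = nat
type_synonym var = nat

datatype fm =
    Bot
  | Atm atm
  | Imp fm fm
  | Tri fm  \<comment> \<open>non-contingency operator\<close>

text \<open>Worlds are drawn from an arbitrary type; the carrier of a frame is an arbitrary nonempty
  set of elements of that type.  Only the values of a valuation on the carrier are relevant.\<close>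

type_synonym 'w frame = "'w set \<times> 'w rel"
type_synonym 'w model = "'w set \<times> 'w rel \<times> ('w \<Rightarrow> atm set)"

definition frame :: "'w frame \<Rightarrow> bool" where
  "frame F \<longleftrightarrow> (case F of (W, R) \<Rightarrow> W \<noteq> {} \<and> R \<subseteq> W \<times> W)"

fun truth :: "'w model \<Rightarrow> 'w \<Rightarrow> fm \<Rightarrow> bool" where
  "truth (W, R, V) w Bot \<longleftrightarrow> False"
| "truth (W, R, V) w (Atm p) \<longleftrightarrow> p \<in> V w"
| "truth (W, R, V) w (Imp \<phi> \<psi>) \<longleftrightarrow> (truth (W, R, V) w \<phi> \<longrightarrow> truth (W, R, V) w \<psi>)"
| "truth (W, R, V) w (Tri \<phi>) \<longleftrightarrow>
     (\<forall>v\<in>W. (w, v) \<in> R \<longrightarrow> truth (W, R, V) v \<phi>) \<or>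
     (\<forall>v\<in>W. (w, v) \<in> R \<longrightarrow> \<not> truth (W, R, V) v \<phi>)"


section \<open>Words, rewriting systems and generalized path conditions\<close>

datatype letter = Fwd | Bwd  \<comment> \<open>the letter $x$ and the converse letter $\overline{x}$\<close>

type_synonym word = "letter list"
type_synonym system = "(letter \<times> word) set"

fun letter_conv :: "letter \<Rightarrow> letter" where
  "letter_conv Fwd = Bwd"
| "letter_conv Bwd = Fwd"

definition word_conv :: "word \<Rightarrow> word" where
  "word_conv \<beta> = rev (map letter_conv \<beta>)"

fun letter_rel :: "'a rel \<Rightarrow> letter \<Rightarrow> 'a rel" where
  "letter_rel Q Fwd = Q"
| "letter_rel Q Bwd = Q\<inverse>"

text \<open>For $Q \subseteq X \times X$, the list \<open>as\<close> is the path $a_0, \dots, a_n$ in $X$ that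
  witnesses membership; the cases of the empty word and of single letters are instances, see the
  lemmas below.\<close>

definition word_rel :: "'a set \<Rightarrow> 'a rel \<Rightarrow> word \<Rightarrow> 'a rel" where
  "word_rel X Q \<beta> =
     {(a, b). \<exists>as. length as = Suc (length \<beta>) \<and> set as \<subseteq> X \<and>
        as ! 0 = a \<and> as ! length \<beta> = b \<and>
        (\<forall>i<length \<beta>. (as ! i, as ! Suc i) \<in> letter_rel Q (\<beta> ! i))}"

lemma word_rel_Nil: "word_rel X Q [] = {(a, a) | a. a \<in> X}"
  by (fastforce simp: word_rel_def length_Suc_conv intro: exI[of _ "[_]"])

lemma word_rel_letter:
  assumes "Q \<subseteq> X \<times> X"
  shows "word_rel X Q [z] = letter_rel Q z"
proof
  show "word_rel X Q [z] \<subseteq> letter_rel Q z"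
    by (auto simp: word_rel_def)
next
  show "letter_rel Q z \<subseteq> word_rel X Q [z]"
  proof
    fix p assume p: "p \<in> letter_rel Q z"
    obtain a b where ab: "p = (a, b)" by (cases p)
    have "a \<in> X" "b \<in> X" using p ab assms by (cases z; auto)+
    then show "p \<in> word_rel X Q [z]"
      using p ab by (auto simp: word_rel_def intro!: exI[of _ "[a, b]"])
  qed
qed

definition step :: "system \<Rightarrow> word rel" where
  "step S = {(\<rho> @ [z] @ \<tau>, \<rho> @ \<eta> @ \<tau>) | \<rho> z \<tau> \<eta>. (z, \<eta>) \<in> S}"

definition lang :: "system \<Rightarrow> word \<Rightarrow> word set" where
  "lang S \<beta> = {\<gamma>. (\<beta>, \<gamma>) \<in> (step S)\<^sup>*}"

definition word_system :: "word \<Rightarrow> system" where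
  "word_system \<alpha> = {(Fwd, \<alpha>), (Bwd, word_conv \<alpha>)}"

datatype gpc = GPC word

fun sat_gpc :: "'w frame \<Rightarrow> gpc \<Rightarrow> bool" where
  "sat_gpc (W, R) (GPC \<alpha>) \<longleftrightarrow> (\<forall>\<beta>\<in>lang (word_system \<alpha>) [Fwd]. word_rel W R \<beta> \<subseteq> R)"

definition gpc_frames :: "gpc set \<Rightarrow> 'w frame set" where
  "gpc_frames G = {F. frame F \<and> (\<forall>g\<in>G. sat_gpc F g)}"

definition gpc_system :: "gpc set \<Rightarrow> system" where
  "gpc_system G = (\<Union>\<alpha>\<in>{\<alpha>. GPC \<alpha> \<in> G}. word_system \<alpha>)"


section \<open>Labelled sequents\<close>

datatype ratom = Rel var var
datatype lform = Lab var fm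
datatype sequent = Seq (control: "ratom set") (antecedent: "lform set") (succedent: "lform set")

definition is_sequent :: "sequent \<Rightarrow> bool" where
  "is_sequent \<sigma> \<longleftrightarrow> finite (control \<sigma>) \<and> finite (antecedent \<sigma>) \<and> finite (succedent \<sigma>)"

fun ratom_vars :: "ratom \<Rightarrow> var set" where
  "ratom_vars (Rel x y) = {x, y}"

fun lform_vars :: "lform \<Rightarrow> var set" where
  "lform_vars (Lab x \<phi>) = {x}"

definition sequent_vars :: "sequent \<Rightarrow> var set" where
  "sequent_vars \<sigma> =
     \<Union> (ratom_vars ` control \<sigma>) \<union> \<Union> (lform_vars ` (antecedent \<sigma> \<union> succedent \<sigma>))"

fun sat_ratom :: "'w model \<Rightarrow> (var \<Rightarrow> 'w) \<Rightarrow> ratom \<Rightarrow> bool" where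
  "sat_ratom (W, R, V) l (Rel x y) \<longleftrightarrow> (l x, l y) \<in> R"

fun sat_lform :: "'w model \<Rightarrow> (var \<Rightarrow> 'w) \<Rightarrow> lform \<Rightarrow> bool" where
  "sat_lform M l (Lab x \<phi>) \<longleftrightarrow> truth M (l x) \<phi>"

fun sat_sequent :: "'w model \<Rightarrow> (var \<Rightarrow> 'w) \<Rightarrow> sequent \<Rightarrow> bool" where
  "sat_sequent M l (Seq \<Omega> \<Gamma> \<Delta>) \<longleftrightarrow>
     ((\<forall>a\<in>\<Omega>. sat_ratom M l a) \<and> (\<forall>f\<in>\<Gamma>. sat_lform M l f) \<longrightarrow> (\<exists>f\<in>\<Delta>. sat_lform M l f))"

definition valid_over :: "'w frame set \<Rightarrow> sequent \<Rightarrow> bool" where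
  "valid_over C \<sigma> \<longleftrightarrow>
     (\<forall>W R V l. (W, R) \<in> C \<and> range l \<subseteq> W \<longrightarrow> sat_sequent (W, R, V) l \<sigma>)"


section \<open>The calculus\<close>

definition closure :: "gpc set \<Rightarrow> sequent \<Rightarrow> ratom set" where
  "closure G \<sigma> =
     (let X = sequent_vars \<sigma>; Q = {(x, y). Rel x y \<in> control \<sigma>}
      in {Rel x y | x y. (x, y) \<in> (\<Union>\<beta>\<in>lang (gpc_system G) [Fwd]. word_rel X Q \<beta>)})"

text \<open>Finiteness is demanded of the initial sequents only; every rule propagates it from the
  premises to the conclusion, so that all nodes of a derivation are sequents
  (lemma \<open>ncl_is_sequent\<close> below).\<close>

inductive ncl :: "gpc set \<Rightarrow> sequent \<Rightarrow> bool" for G :: "gpc set" where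
  init_bot:
    "is_sequent (Seq \<Omega> (\<Gamma> \<union> {Lab x Bot}) \<Delta>) \<Longrightarrow>
     ncl G (Seq \<Omega> (\<Gamma> \<union> {Lab x Bot}) \<Delta>)"
| init_id:
    "is_sequent (Seq \<Omega> (\<Gamma> \<union> {Lab x \<phi>}) ({Lab x \<phi>} \<union> \<Delta>)) \<Longrightarrow>
     ncl G (Seq \<Omega> (\<Gamma> \<union> {Lab x \<phi>}) ({Lab x \<phi>} \<union> \<Delta>))"
| ImpL:
    "ncl G (Seq \<Omega> \<Gamma> ({Lab x \<phi>} \<union> \<Delta>)) \<Longrightarrow>
     ncl G (Seq \<Omega> (\<Gamma> \<union> {Lab x \<psi>}) \<Delta>) \<Longrightarrow>
     ncl G (Seq \<Omega> (\<Gamma> \<union> {Lab x (Imp \<phi> \<psi>)}) \<Delta>)"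
| ImpR:
    "ncl G (Seq \<Omega> (\<Gamma> \<union> {Lab x \<phi>}) ({Lab x \<psi>} \<union> \<Delta>)) \<Longrightarrow>
     ncl G (Seq \<Omega> \<Gamma> ({Lab x (Imp \<phi> \<psi>)} \<union> \<Delta>))"
| TriL:
    "ncl G (Seq \<Omega> (\<Gamma> \<union> {Lab x (Tri \<phi>)} \<union> {Lab y \<phi> | y. Rel x y \<in> \<Omega>}) \<Delta>) \<Longrightarrow>
     ncl G (Seq \<Omega> (\<Gamma> \<union> {Lab x (Tri \<phi>)}) ({Lab y \<phi> | y. Rel x y \<in> \<Omega>} \<union> \<Delta>)) \<Longrightarrow>
     ncl G (Seq \<Omega> (\<Gamma> \<union> {Lab x (Tri \<phi>)}) \<Delta>)"
| TriR:
    "ncl G (Seq (\<Omega> \<union> {Rel x y, Rel x z}) (\<Gamma> \<union> {Lab y \<phi>})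
       ({Lab z \<phi>, Lab x (Tri \<phi>)} \<union> \<Delta>)) \<Longrightarrow>
     y \<noteq> z \<Longrightarrow>
     y \<notin> sequent_vars (Seq \<Omega> \<Gamma> ({Lab x (Tri \<phi>)} \<union> \<Delta>)) \<Longrightarrow>
     z \<notin> sequent_vars (Seq \<Omega> \<Gamma> ({Lab x (Tri \<phi>)} \<union> \<Delta>)) \<Longrightarrow>
     ncl G (Seq \<Omega> \<Gamma> ({Lab x (Tri \<phi>)} \<union> \<Delta>))"
| rG:
    "ncl G (Seq (closure G (Seq \<Omega> \<Gamma> \<Delta>)) \<Gamma> \<Delta>) \<Longrightarrow>
     ncl G (Seq \<Omega> \<Gamma> \<Delta>)"

lemma control_subset_closure: "control \<sigma> \<subseteq> closure G \<sigma>"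
proof
  fix r assume r: "r \<in> control \<sigma>"
  obtain x y where xy: "r = Rel x y" by (cases r)
  let ?X = "sequent_vars \<sigma>" and ?Q = "{(x, y). Rel x y \<in> control \<sigma>}"
  have "?Q \<subseteq> ?X \<times> ?X" by (force simp: sequent_vars_def)
  then have "(x, y) \<in> word_rel ?X ?Q [Fwd]"
    using r xy by (simp add: word_rel_letter)
  moreover have "[Fwd] \<in> lang (gpc_system G) [Fwd]" by (simp add: lang_def)
  ultimately show "r \<in> closure G \<sigma>"
    unfolding closure_def Let_def xy by blast
qed

lemma ncl_is_sequent: "ncl G \<sigma> \<Longrightarrow> is_sequent \<sigma>"
proof (induction rule: ncl.induct)
  case (rG \<Omega> \<Gamma> \<Delta>)
  then show ?case
    using control_subset_closure[of "Seq \<Omega> \<Gamma> \<Delta>" G]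
    by (auto simp: is_sequent_def intro: finite_subset)
qed (auto simp: is_sequent_def)

end

theory Submission
  imports Defs
begin

text \<open>In a G-frame every production \<open>z \<mapsto> \<eta>\<close> of the combined system satisfies
  \<open>R\<^bsub>\<eta>\<^esub> \<subseteq> R\<^bsub>z\<^esub>\<close>. Relations of words compose along concatenation, so this
  inclusion passes through rewriting steps and \<open>R\<^bsub>\<beta>\<^esub> \<subseteq> R\<close> for every word
  derivable from \<open>x\<close>, even when productions of different conditions are interleaved.
  An assignment satisfying the control is a homomorphism into the frame and hence also satisfies
  the closed control.\<close>

section \<open>Composition, converse and homomorphic images of word relations\<close>

lemma word_rel_Cons:
  assumes "Q \<subseteq> X \<times> X"
  shows "word_rel X Q (z # \<beta>) = letter_rel Q z O word_rel X Q \<beta>"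
proof (intro equalityI subrelI)
  fix a c assume "(a, c) \<in> word_rel X Q (z # \<beta>)"
  then obtain as where as: "length as = Suc (Suc (length \<beta>))" "set as \<subseteq> X"
      "as ! 0 = a" "as ! Suc (length \<beta>) = c"
      "\<forall>i<Suc (length \<beta>). (as ! i, as ! Suc i) \<in> letter_rel Q ((z # \<beta>) ! i)"
    by (auto simp: word_rel_def)
  then obtain bs where bs: "as = a # bs" by (cases as) auto
  have "(a, bs ! 0) \<in> letter_rel Q z" using spec[OF as(5), of 0] as(3) bs by simp
  moreover have "(bs ! 0, c) \<in> word_rel X Q \<beta>"
    using as bs by (auto simp: word_rel_def intro!: exI[of _ bs])
  ultimately show "(a, c) \<in> letter_rel Q z O word_rel X Q \<beta>" by blast
next
  fix a c assume "(a, c) \<in> letter_rel Q z O word_rel X Q \<beta>"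
  then obtain b where ab: "(a, b) \<in> letter_rel Q z" and "(b, c) \<in> word_rel X Q \<beta>"
    by blast
  then obtain bs where bs: "length bs = Suc (length \<beta>)" "set bs \<subseteq> X"
      "bs ! 0 = b" "bs ! length \<beta> = c"
      "\<forall>i<length \<beta>. (bs ! i, bs ! Suc i) \<in> letter_rel Q (\<beta> ! i)"
    by (auto simp: word_rel_def)
  \<comment> \<open>The path \<open>a # bs\<close> has to stay inside \<open>X\<close>; for its new
    first point this comes from \<open>Q\<close> being a relation on \<open>X\<close>.\<close>
  have "a \<in> X" using ab assms by (cases z) auto
  then show "(a, c) \<in> word_rel X Q (z # \<beta>)"
    using ab bs
    by (auto simp: word_rel_def nth_Cons split: nat.split intro!: exI[of _ "a # bs"])
qed

lemma word_rel_subset: "word_rel X Q \<beta> \<subseteq> X \<times> X"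
  by (force simp: word_rel_def dest: nth_mem)

lemma word_rel_append:
  assumes "Q \<subseteq> X \<times> X"
  shows "word_rel X Q (\<beta> @ \<gamma>) = word_rel X Q \<beta> O word_rel X Q \<gamma>"
proof (induction \<beta>)
  case Nil
  \<comment> \<open>The identity on \<open>X\<close> is a left unit for composition because word
    relations live on \<open>X\<close>.\<close>
  show ?case using word_rel_subset[of X Q \<gamma>] by (auto simp: word_rel_Nil)
next
  case (Cons z \<beta>)
  then show ?case by (simp add: word_rel_Cons[OF assms] O_assoc)
qed

lemma letter_rel_conv: "letter_rel Q (letter_conv z) = (letter_rel Q z)\<inverse>"
  by (cases z) auto

text \<open>This transfers an inclusion for \<open>\<alpha>\<close> to the converse production,
  whose right-hand side is \<open>word_conv \<alpha>\<close>. Reversal moves the head letter to the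
  end, just as converse reverses a composition.\<close>

lemma word_rel_conv:
  assumes "Q \<subseteq> X \<times> X"
  shows "word_rel X Q (word_conv \<beta>) = (word_rel X Q \<beta>)\<inverse>"
proof (induction \<beta>)
  case Nil
  show ?case by (auto simp: word_conv_def word_rel_Nil)
next
  case (Cons z \<beta>)
  have "word_conv (z # \<beta>) = word_conv \<beta> @ [letter_conv z]" by (simp add: word_conv_def)
  then have "word_rel X Q (word_conv (z # \<beta>)) = word_rel X Q (word_conv \<beta>) O (letter_rel Q z)\<inverse>"
    by (simp only: word_rel_append[OF assms] word_rel_letter[OF assms] letter_rel_conv)
  with Cons show ?case by (simp add: word_rel_Cons[OF assms] converse_relcomp)
qed

lemma word_rel_hom:
  assumes "Q \<subseteq> X \<times> X" "R \<subseteq> W \<times> W" "range l \<subseteq> W"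
    and hom: "\<And>a b. (a, b) \<in> Q \<Longrightarrow> (l a, l b) \<in> R"
  shows "(a, b) \<in> word_rel X Q \<beta> \<Longrightarrow> (l a, l b) \<in> word_rel W R \<beta>"
proof (induction \<beta> arbitrary: a)
  case Nil
  \<comment> \<open>The empty word relates only points of the domain, so the image point must lie in
    \<open>W\<close>.\<close>
  then show ?case using assms(3) by (auto simp: word_rel_Nil)
next
  case (Cons z \<beta>)
  then obtain c where c: "(a, c) \<in> letter_rel Q z" "(c, b) \<in> word_rel X Q \<beta>"
    by (auto simp: word_rel_Cons[OF assms(1)])
  have "(l a, l c) \<in> letter_rel R z" using c(1) hom by (cases z) auto
  then show ?case using Cons.IH[OF c(2)] by (auto simp: word_rel_Cons[OF assms(2)])
qed

section \<open>Rewriting in frames and soundness of closing the control\<close>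

lemma word_rel_lang_antimono:
  assumes "R \<subseteq> W \<times> W"
    and prod: "\<And>z \<eta>. (z, \<eta>) \<in> S \<Longrightarrow> word_rel W R \<eta> \<subseteq> letter_rel R z"
    and "\<gamma> \<in> lang S \<beta>"
  shows "word_rel W R \<gamma> \<subseteq> word_rel W R \<beta>"
proof -
  have "(\<beta>, \<gamma>) \<in> (step S)\<^sup>*" using assms(3) by (simp add: lang_def)
  then show ?thesis
  proof induction
    case (step \<gamma> \<delta>)
    obtain \<rho> z \<tau> \<eta> where eq: "\<gamma> = \<rho> @ [z] @ \<tau>" "\<delta> = \<rho> @ \<eta> @ \<tau>" and z: "(z, \<eta>) \<in> S"
      using step.hyps(2) unfolding step_def by blast
    \<comment> \<open>Composition is monotone, so shrinking the middle factor between the relations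
      of \<open>\<rho>\<close> and \<open>\<tau>\<close> shrinks the whole.\<close>
    have "word_rel W R \<delta> \<subseteq> word_rel W R \<gamma>"
      unfolding eq word_rel_append[OF assms(1)] word_rel_letter[OF assms(1)]
      using prod[OF z] by (intro relcomp_mono order_refl)
    with step.IH show ?case by blast
  qed simp
qed

text \<open>Each condition enters through the word \<open>\<alpha>\<close> itself, one rewriting
  step away from \<open>[Fwd]\<close>; the production for \<open>Bwd\<close> then follows by taking
  converses.\<close>

lemma gpc_system_production:
  assumes "(W, R) \<in> gpc_frames G" "(z, \<eta>) \<in> gpc_system G"
  shows "word_rel W R \<eta> \<subseteq> letter_rel R z"
proof -
  have R: "R \<subseteq> W \<times> W" using assms(1) by (auto simp: gpc_frames_def frame_def)
  obtain \<alpha> where \<alpha>: "GPC \<alpha> \<in> G" "(z, \<eta>) \<in> word_system \<alpha>"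
    using assms(2) by (auto simp: gpc_system_def)
  have "([Fwd], \<alpha>) \<in> step (word_system \<alpha>)"
    by (force simp: step_def word_system_def)
  then have "\<alpha> \<in> lang (word_system \<alpha>) [Fwd]" by (auto simp: lang_def)
  moreover have "sat_gpc (W, R) (GPC \<alpha>)" using assms(1) \<alpha>(1) unfolding gpc_frames_def by blast
  ultimately have "word_rel W R \<alpha> \<subseteq> R" by simp
  then show ?thesis using \<alpha>(2) by (auto simp: word_system_def word_rel_conv[OF R])
qed

lemma closure_sound:
  assumes F: "(W, R) \<in> gpc_frames G" and l: "range l \<subseteq> W"
    and sat: "\<forall>a\<in>control \<sigma>. sat_ratom (W, R, V) l a"
    and a: "a \<in> closure G \<sigma>"
  shows "sat_ratom (W, R, V) l a"
proof -
  have R: "R \<subseteq> W \<times> W" using F by (auto simp: gpc_frames_def frame_def)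
  define Q where "Q = {(x, y). Rel x y \<in> control \<sigma>}"
  have Q: "Q \<subseteq> sequent_vars \<sigma> \<times> sequent_vars \<sigma>"
    by (force simp: Q_def sequent_vars_def)
  obtain x y \<beta> where xy: "a = Rel x y" "\<beta> \<in> lang (gpc_system G) [Fwd]"
      "(x, y) \<in> word_rel (sequent_vars \<sigma>) Q \<beta>"
    using a unfolding closure_def Let_def Q_def by blast
  have "(l u, l v) \<in> R" if "(u, v) \<in> Q" for u v
    using that sat by (auto simp: Q_def)
  \<comment> \<open>A path through the labels is carried by \<open>l\<close> to a path in the frame,
    which the conditions then contract to a single edge.\<close>
  then have "(l x, l y) \<in> word_rel W R \<beta>" using word_rel_hom[OF Q R l _ xy(3)] by blast
  also have "\<dots> \<subseteq> word_rel W R [Fwd]"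
    using word_rel_lang_antimono[OF R gpc_system_production[OF F] xy(2)] .
  finally show ?thesis by (simp add: xy(1) word_rel_letter[OF R])
qed

section \<open>Reassigning labels, the rules for \<open>Tri\<close>, and induction over
  derivations\<close>

lemma sat_ratom_cong:
  assumes "\<And>x. x \<in> ratom_vars a \<Longrightarrow> l x = l' x"
  shows "sat_ratom M l a \<longleftrightarrow> sat_ratom M l' a"
  using assms by (cases M; cases a) auto

lemma sat_lform_cong:
  assumes "\<And>x. x \<in> lform_vars f \<Longrightarrow> l x = l' x"
  shows "sat_lform M l f \<longleftrightarrow> sat_lform M l' f"
  using assms by (cases f) auto

text \<open>This allows the fresh labels of the right rule for \<open>Tri\<close> to be reassigned
  without affecting its conclusion.\<close>

lemma sat_sequent_cong:
  assumes "\<And>x. x \<in> sequent_vars \<sigma> \<Longrightarrow> l x = l' x"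
  shows "sat_sequent M l \<sigma> \<longleftrightarrow> sat_sequent M l' \<sigma>"
proof (cases \<sigma>)
  case (Seq \<Omega> \<Gamma> \<Delta>)
  have "sat_ratom M l a \<longleftrightarrow> sat_ratom M l' a" if "a \<in> \<Omega>" for a
    using that assms Seq by (intro sat_ratom_cong) (auto simp: sequent_vars_def)
  moreover have "sat_lform M l f \<longleftrightarrow> sat_lform M l' f" if "f \<in> \<Gamma> \<union> \<Delta>" for f
    using that assms Seq by (intro sat_lform_cong) (auto simp: sequent_vars_def)
  ultimately show ?thesis by (simp add: Seq)
qed

text \<open>If \<open>Tri \<phi>\<close> fails at \<open>l x\<close>, then \<open>l x\<close> has a
  successor with \<open>\<phi>\<close> and one without. Sending \<open>y\<close> and
  \<open>z\<close> to them turns the premise into the conclusion. The premise is assumed for all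
  assignments so that it covers this modified one.\<close>

lemma TriR_sound:
  fixes R :: "'w rel"
  assumes prem: "\<And>l. range l \<subseteq> W \<Longrightarrow> sat_sequent (W, R, V) l
      (Seq (\<Omega> \<union> {Rel x y, Rel x z}) (\<Gamma> \<union> {Lab y \<phi>}) ({Lab z \<phi>, Lab x (Tri \<phi>)} \<union> \<Delta>))"
    and "y \<noteq> z"
    and y: "y \<notin> sequent_vars (Seq \<Omega> \<Gamma> ({Lab x (Tri \<phi>)} \<union> \<Delta>))"
    and z: "z \<notin> sequent_vars (Seq \<Omega> \<Gamma> ({Lab x (Tri \<phi>)} \<union> \<Delta>))"
    and l: "range l \<subseteq> W"
  shows "sat_sequent (W, R, V) l (Seq \<Omega> \<Gamma> ({Lab x (Tri \<phi>)} \<union> \<Delta>))"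
proof (cases "truth (W, R, V) (l x) (Tri \<phi>)")
  case True
  then show ?thesis by auto
next
  case False
  then obtain u v where
      u: "u \<in> W" "(l x, u) \<in> R" "truth (W, R, V) u \<phi>" and
      v: "v \<in> W" "(l x, v) \<in> R" "\<not> truth (W, R, V) v \<phi>"
    by auto
  let ?l = "l(y := u, z := v)"
  \<comment> \<open>As \<open>x\<close> occurs in the conclusion, the update leaves its value alone,
    so \<open>u\<close> and \<open>v\<close> are successors of \<open>?l x\<close>.\<close>
  have "x \<noteq> y" "x \<noteq> z" using y z by (auto simp: sequent_vars_def)
  moreover have "range ?l \<subseteq> W" using l u v by auto
  \<comment> \<open>Under \<open>?l\<close> the added atoms and \<open>y : \<phi>\<close> are true
    while \<open>z : \<phi>\<close> is false; \<open>y \<noteq> z\<close> keeps the value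
    \<open>u\<close> at \<open>y\<close>.\<close>
  ultimately have "sat_sequent (W, R, V) ?l (Seq \<Omega> \<Gamma> ({Lab x (Tri \<phi>)} \<union> \<Delta>))"
    using prem[of ?l] \<open>y \<noteq> z\<close> u v by auto
  moreover have "?l w = l w" if "w \<in> sequent_vars (Seq \<Omega> \<Gamma> ({Lab x (Tri \<phi>)} \<union> \<Delta>))" for w
    using that y z by auto
  ultimately show ?thesis using sat_sequent_cong by blast
qed

text \<open>The two premises match the two disjuncts in the truth condition of \<open>Tri\<close>:
  \<open>\<phi>\<close> holds at all successors named in the control, or at none of them.\<close>

lemma TriL_sound:
  assumes R: "R \<subseteq> W \<times> W"
    and "sat_sequent (W, R, V) l
      (Seq \<Omega> (\<Gamma> \<union> {Lab x (Tri \<phi>)} \<union> {Lab y \<phi> | y. Rel x y \<in> \<Omega>}) \<Delta>)"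
    and "sat_sequent (W, R, V) l
      (Seq \<Omega> (\<Gamma> \<union> {Lab x (Tri \<phi>)}) ({Lab y \<phi> | y. Rel x y \<in> \<Omega>} \<union> \<Delta>))"
  shows "sat_sequent (W, R, V) l (Seq \<Omega> (\<Gamma> \<union> {Lab x (Tri \<phi>)}) \<Delta>)"
  unfolding sat_sequent.simps
proof (intro impI, elim conjE)
  assume \<Omega>: "\<forall>a\<in>\<Omega>. sat_ratom (W, R, V) l a"
    and \<Gamma>: "\<forall>f\<in>\<Gamma> \<union> {Lab x (Tri \<phi>)}. sat_lform (W, R, V) l f"
  have succ: "(l x, l y) \<in> R \<and> l y \<in> W" if "Rel x y \<in> \<Omega>" for y
    using that \<Omega> R by force
  have "truth (W, R, V) (l x) (Tri \<phi>)" using \<Gamma> by simp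
  then consider
      "\<forall>y. Rel x y \<in> \<Omega> \<longrightarrow> truth (W, R, V) (l y) \<phi>"
    | "\<forall>y. Rel x y \<in> \<Omega> \<longrightarrow> \<not> truth (W, R, V) (l y) \<phi>"
    using succ by auto
  then show "\<exists>f\<in>\<Delta>. sat_lform (W, R, V) l f"
  proof cases
    case 1
    then show ?thesis using assms(2) \<Omega> \<Gamma> by auto
  next
    case 2
    \<comment> \<open>All formulae added to the succedent are false here, so the true one must come
      from \<open>\<Delta>\<close>.\<close>
    then show ?thesis using assms(3) \<Omega> \<Gamma> by auto
  qed
qed

text \<open>The model stays fixed while the induction generalises over \<open>l\<close>, since the
  right rule for \<open>Tri\<close> needs its premise at a changed assignment.\<close>

lemma ncl_sound:
  assumes F: "(W, R) \<in> gpc_frames G"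
  shows "ncl G \<sigma> \<Longrightarrow> range l \<subseteq> W \<Longrightarrow> sat_sequent (W, R, V) l \<sigma>"
proof (induction arbitrary: l rule: ncl.induct)
  case (init_bot \<Omega> \<Gamma> x \<Delta>)
  then show ?case by simp
next
  case (init_id \<Omega> \<Gamma> x \<phi> \<Delta>)
  then show ?case by simp
next
  case (ImpL \<Omega> \<Gamma> x \<phi> \<Delta> \<psi>)
  show ?case using ImpL.IH[OF ImpL.prems] by auto
next
  case (ImpR \<Omega> \<Gamma> x \<phi> \<psi> \<Delta>)
  show ?case using ImpR.IH[OF ImpR.prems] by auto
next
  case (TriL \<Omega> \<Gamma> x \<phi> \<Delta>)
  have "R \<subseteq> W \<times> W" using F by (auto simp: gpc_frames_def frame_def)
  then show ?case using TriL.IH[OF TriL.prems] by (rule TriL_sound)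
next
  case (TriR \<Omega> x y z \<Gamma> \<phi> \<Delta>)
  show ?case using TriR.IH TriR.hyps(2-4) TriR.prems by (rule TriR_sound)
next
  case (rG \<Omega> \<Gamma> \<Delta>)
  have "\<forall>a\<in>closure G (Seq \<Omega> \<Gamma> \<Delta>). sat_ratom (W, R, V) l a"
    if "\<forall>a\<in>\<Omega>. sat_ratom (W, R, V) l a"
    using closure_sound[OF F rG.prems, of "Seq \<Omega> \<Gamma> \<Delta>"] that by simp
  then show ?case using rG.IH[OF rG.prems] by simp
qed

theorem mainTheorem1:
  fixes G :: "gpc set" and \<sigma> :: sequent
  assumes "finite G"
    and "is_sequent \<sigma>"
    and "ncl G \<sigma>"
  shows "valid_over (gpc_frames G :: 'w frame set) \<sigma>"
  using ncl_sound assms(3) unfolding valid_over_def by blast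

end
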